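(* For every prime power $q=p^r$ with $p\neq 2$ one has $\mathcal{I}(\mathbb{F}_q,2)=q$.
   Context: For points $u=(u_1,u_2)$, $v=(v_1,v_2)$ in $\mathbb{F}_q^2$ the squared distance is $d^2(u,v)=(u_1-v_1)^2+(u_2-v_2)^2\in\mathbb{F}_q$. Two points are at integral distance if $d^2(u,v)=t^2$ for some $t\in\mathbb{F}_q$ (so $0$ is allowed). An integral point set in $\mathbb{F}_q^2$ is a set of points that are pairwise at integral distance. $\mathcal{I}(\mathbb{F}_q,2)$ denotes the maximum cardinality of an integral point set in $\mathbb{F}_q^2$. *)

theory Defs
  imports "HOL-Computational_Algebra.Primes" "HOL-Library.Cardinality"
begin

definition sq_dist :: "'a::field \<times> 'a \<Rightarrow> 'a \<times> 'a \<Rightarrow> 'a" where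
  "sq_dist u v = (fst u - fst v)\<^sup>2 + (snd u - snd v)\<^sup>2"

(* t = 0 is allowed, so distinct points at squared distance 0 are at integral distance. *)
definition integral_distance :: "'a::field \<times> 'a \<Rightarrow> 'a \<times> 'a \<Rightarrow> bool" where
  "integral_distance u v \<longleftrightarrow> (\<exists>t. sq_dist u v = t\<^sup>2)"

definition integral_point_set :: "('a::field \<times> 'a) set \<Rightarrow> bool" where
  "integral_point_set P \<longleftrightarrow> pairwise integral_distance P"

(* The finite field is passed as a type. Max is attained: there are finitely many point
   sets, and the empty set is integral. *)
definition max_integral_card :: "'a::{field,finite} itself \<Rightarrow> nat" where
  "max_integral_card _ = Max (card ` {P :: ('a \<times> 'a) set. integral_point_set P})"

end

(* Some sum of two squares is a nonsquare, so there is a direction of which no nonzero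
   multiple has square norm.  The q parallel lines in that direction cover the plane and
   each contains at most one point of an integral point set; a coordinate axis attains q. *)
theory Submission
  imports Defs "HOL-Number_Theory.Residues"
begin

text \<open>The characteristic of a finite field divides its order, so characteristic 2 would force
  even order.\<close>

lemma two_neq_zero_of_odd_card:
  assumes "odd CARD('a::{field,finite})"
  shows "(2::'a) \<noteq> 0"
proof
  assume "(2::'a) = 0"
  then have "of_nat 2 = (0::'a)" by simp
  then have "CHAR('a) dvd 2"
    by (simp only: of_nat_eq_0_iff_char_dvd)
  moreover have "CHAR('a) \<noteq> 1" by simp
  ultimately have "CHAR('a) = 2"
    by (meson prime_nat_iff two_is_prime_nat)
  then show False
    using CHAR_dvd_CARD[where 'a='a] assms by simp
qed

text \<open>Squaring identifies 1 and -1, so it is not injective; on a finite set it then cannot be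
  surjective.\<close>

lemma exists_nonsquare:
  assumes "(2::'a::{field,finite}) \<noteq> 0"
  shows "\<exists>x::'a. \<forall>t. x \<noteq> t\<^sup>2"
proof (rule ccontr)
  assume "\<not> ?thesis"
  then have "surj (\<lambda>t::'a. t\<^sup>2)" by (metis surjI)
  then have "inj (\<lambda>t::'a. t\<^sup>2)" by (rule finite_UNIV_surj_inj[OF finite_class.finite_UNIV])
  then have "(1::'a) = -1" by (auto dest: injD[where x = 1 and y = "-1"])
  then show False using assms by (metis add.right_inverse one_add_one)
qed

text \<open>Otherwise the squares are closed under addition. Adding 1 repeatedly makes -1 a square,
  so differences of squares are squares too; as 2 is invertible, every element is such a
  difference.\<close>

lemma exists_nonsquare_sum_two_squares:
  assumes two: "(2::'a::{field,finite}) \<noteq> 0"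
  shows "\<exists>a b::'a. \<forall>t. a\<^sup>2 + b\<^sup>2 \<noteq> t\<^sup>2"
proof (rule ccontr)
  assume "\<not> ?thesis"
  then have add: "\<exists>t. a\<^sup>2 + b\<^sup>2 = t\<^sup>2" for a b :: 'a by blast
  have nat: "\<exists>t::'a. of_nat n = t\<^sup>2" for n
  proof (induction n)
    case 0
    show ?case by (rule exI[of _ 0]) simp
  next
    case (Suc n)
    then show ?case using add[of 1] by auto
  qed
  \<comment> \<open>Positivity keeps the subtraction \<open>CHAR('a) - 1\<close> in the naturals
    from truncating, so its image in the field really is -1.\<close>
  have "CHAR('a) > 0" by (rule finite_imp_CHAR_pos) simp
  then have "(of_nat (CHAR('a) - 1)::'a) = -1" by (simp add: of_nat_diff)
  then obtain i :: 'a where i: "-1 = i\<^sup>2" using nat by metis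
  have "\<exists>t. x = t\<^sup>2" for x :: 'a
  proof -
    \<comment> \<open>Chosen so that x = y^2 - z^2; the root \<open>i\<close> of -1 turns this into
      a sum of two squares.\<close>
    define y z where "y = (x + 1) / 2" and "z = (x - 1) / 2"
    have "y - z = 1" and "y + z = x"
      using two
      by (simp_all add: y_def z_def flip: diff_divide_distrib add_divide_distrib mult_2)
    then have "x = (y + z) * (y - z)" by simp
    also have "\<dots> = y\<^sup>2 + i\<^sup>2 * z\<^sup>2"
      unfolding i[symmetric] by (simp add: power2_eq_square algebra_simps)
    finally have "x = y\<^sup>2 + (i * z)\<^sup>2" by (simp add: power_mult_distrib)
    then show ?thesis using add by metis
  qed
  then show False using exists_nonsquare[OF two] by blast
qed

lemma card_integral_point_set_le:
  fixes P :: "('a::{field,finite} \<times> 'a) set"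
  assumes two: "(2::'a) \<noteq> 0" and P: "integral_point_set P"
  shows "card P \<le> CARD('a)"
proof -
  obtain a b :: 'a where ab: "\<And>t. a\<^sup>2 + b\<^sup>2 \<noteq> t\<^sup>2"
    using exists_nonsquare_sum_two_squares[OF two] by blast
  (* The fibres of f are the lines in direction (a, b). *)
  define f where "f u = b * fst u - a * snd u" for u :: "'a \<times> 'a"
  have "inj_on f P"
  proof (rule inj_onI, rule ccontr)
    fix u v assume "u \<in> P" "v \<in> P" "f u = f v" "u \<noteq> v"
    then obtain t where t: "sq_dist u v = t\<^sup>2"
      using P by (auto simp: integral_point_set_def pairwise_def integral_distance_def)
    define x y where "x = fst u - fst v" and "y = snd u - snd v"
    have xy: "b * x = a * y"
      using \<open>f u = f v\<close> by (simp add: f_def x_def y_def algebra_simps)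
    have t': "x\<^sup>2 + y\<^sup>2 = t\<^sup>2"
      using t by (simp add: sq_dist_def x_def y_def)
    have "x \<noteq> 0 \<or> y \<noteq> 0"
      using \<open>u \<noteq> v\<close> by (auto simp: x_def y_def prod_eq_iff)
    moreover have "a \<noteq> 0 \<or> b \<noteq> 0"
      using ab[of 0] by auto
    \<comment> \<open>Equal values of \<open>f\<close> make the difference vector (x, y) parallel to
      (a, b). The factor is read off from a coordinate of (a, b) that is nonzero.\<close>
    ultimately obtain k where "k \<noteq> 0" "x = k * a" "y = k * b"
    proof (cases "a = 0")
      case True
      with xy \<open>a \<noteq> 0 \<or> b \<noteq> 0\<close> \<open>x \<noteq> 0 \<or> y \<noteq> 0\<close> show ?thesis
        by (intro that[of "y / b"]) auto
    next
      case False
      with xy \<open>x \<noteq> 0 \<or> y \<noteq> 0\<close> show ?thesis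
        by (intro that[of "x / a"]) (auto simp: field_simps)
    qed
    \<comment> \<open>Scaling a vector by k multiplies its norm by k^2, so for nonzero k the norm of
      (a, b) would be a square as well.\<close>
    with t' have "k\<^sup>2 * (a\<^sup>2 + b\<^sup>2) = t\<^sup>2"
      by (simp add: power_mult_distrib distrib_left)
    then have "a\<^sup>2 + b\<^sup>2 = (t / k)\<^sup>2"
      using \<open>k \<noteq> 0\<close> by (simp add: power_divide eq_divide_eq mult.commute)
    then show False using ab by blast
  qed
  then show ?thesis by (rule card_inj_on_le) auto
qed

text \<open>On the axis the second summand of \<open>sq_dist\<close> vanishes, leaving the square of
  the difference of first coordinates.\<close>

lemma integral_point_set_axis: "integral_point_set (UNIV \<times> {0})"
  by (auto simp: integral_point_set_def pairwise_def integral_distance_def sq_dist_def)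

theorem theorem7:
  fixes p r q :: nat
  assumes "prime p" and "r \<ge> 1" and "q = p ^ r" and "p \<noteq> 2"
    and "CARD('a::{field,finite}) = q"
  shows "max_integral_card TYPE('a) = q"
proof -
  have "odd p" using assms(1,4) by (metis primes_dvd_imp_eq two_is_prime_nat)
  then have two: "(2::'a) \<noteq> 0"
    using assms by (intro two_neq_zero_of_odd_card) simp
  show ?thesis
    unfolding max_integral_card_def
  proof (rule Max_eqI)
    fix n assume "n \<in> card ` {P :: ('a \<times> 'a) set. integral_point_set P}"
    then show "n \<le> q"
      using card_integral_point_set_le[OF two] assms(5) by auto
  next
    have "card (UNIV \<times> {0} :: ('a \<times> 'a) set) = q"
      using assms(5) by (simp add: card_cartesian_product)
    then show "q \<in> card ` {P :: ('a \<times> 'a) set. integral_point_set P}"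
      using integral_point_set_axis by (metis image_eqI mem_Collect_eq)
  qed simp
qed

end
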